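(* Let $r\ge 1$ and $h$ be positive integers and let $d\geq \max\{40,2h\}$. Let $G=G(U\cup W, U\rightarrow W)$ be a bipartite digraph such that $|N_W^+(u)|\geq d$ for each $u\in U$. Let $H=H(A\cup B,A\rightarrow B)$ be an $h$-vertex bipartite digraph such that $|N_B^+(a)|\leq r$ for each $a\in A$. If $$\frac{1}{2|W|}\left(\frac{|U|}{4h}\right)^{1/r}\frac{d}{2}\geq \max\{20,h\},$$ then $G$ contains a copy of $H$.
   Context: The notation $G=G(U\cup W,U\rightarrow W)$ means $G$ is a bipartite digraph with vertex bipartition $U\cup W$ in which every arc goes from $U$ to $W$ (similarly for $H(A\cup B,A\rightarrow B)$). For $u\in U$, $N_W^+(u)$ is the set of out-neighbours of $u$ in $W$; $N_B^+(a)$ is the set of out-neighbours of $a$ in $B$. A copy of $H$ in $G$ is a (not necessarily induced) subdigraph of $G$ isomorphic to $H$. *)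

theory Defs
  imports Complex_Main "Graph_Theory.Graph_Theory"
begin

text \<open>The notation \<open>G = G(U \<union> W, U \<rightarrow> W)\<close>. The library locale \<^locale>\<open>digraph\<close> supplies
  finiteness and the absence of loops and parallel arcs.\<close>

definition bipartite_digraph :: "('a, 'b) pre_digraph \<Rightarrow> 'a set \<Rightarrow> 'a set \<Rightarrow> bool" where
  "bipartite_digraph G U W \<longleftrightarrow>
     digraph G \<and> verts G = U \<union> W \<and> U \<inter> W = {} \<and>
     (\<forall>e \<in> arcs G. tail G e \<in> U \<and> head G e \<in> W)"

definition out_nbrs :: "('a, 'b) pre_digraph \<Rightarrow> 'a set \<Rightarrow> 'a \<Rightarrow> 'a set" where
  "out_nbrs G X v = {x \<in> X. v \<rightarrow>\<^bsub>G\<^esub> x}"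

definition contains_copy :: "('a, 'b) pre_digraph \<Rightarrow> ('c, 'd) pre_digraph \<Rightarrow> bool" where
  "contains_copy G H \<longleftrightarrow> (\<exists>S. subgraph S G \<and> digraph_iso H S)"

end

theory Submission
  imports Defs "HOL-Library.FuncSet"
begin

text \<open>Shrink every out-neighbourhood to a set \<open>N u\<close> of the same size \<open>D \<ge> d\<close> and choose
  \<open>u \<in> U\<close> and an injection \<open>f\<close> from \<open>B\<close> to \<open>N u\<close> uniformly at random. For a vertex \<open>a \<in> A\<close> with
  \<open>s\<close> out-neighbours, an image \<open>t\<close> of them with at most \<open>h\<close> common in-neighbours is hit with
  probability at most \<open>h / |U|\<close> times the reciprocal of the falling factorial
  \<open>D (D - 1) \<dots> (D - s + 1) \<ge> (D / 2) ^ s\<close>, and there are at most \<open>|W| ^ s\<close> choices of \<open>t\<close>.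
  The numerical hypothesis makes this less than \<open>1 / h\<close>, so some choice of \<open>(u, f)\<close> is good for
  all \<open>a\<close> at once; the vertices of \<open>A\<close> are then embedded greedily.\<close>

section \<open>Counting injections and the union bound\<close>

lemma card_injections:
  assumes "finite A" "finite C"
  shows "card {f \<in> A \<rightarrow>\<^sub>E C. inj_on f A} = (\<Prod>i<card A. card C - i)"
  \<comment> \<open>The product is also right for \<open>card C < card A\<close>: truncated
    subtraction makes the factor at \<open>i = card C\<close> zero.\<close>
  using card_inj_on_subset_funcset[of A C A] assms by (simp add: lessThan_atLeast0)

text \<open>With \<open>b = card B\<close> and \<open>s = card S\<close> this separates the
  placements of \<open>S\<close> from the extensions to \<open>B - S\<close>, so that the extensions
  cancel in the union bound.\<close>

lemma falling_factorial_split: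
  fixes n :: nat
  assumes "s \<le> b"
  shows "(\<Prod>i<b. n - i) = (\<Prod>i<s. n - i) * (\<Prod>i<b - s. n - s - i)"
proof -
  have "(\<Prod>i<s + k. n - i) = (\<Prod>i<s. n - i) * (\<Prod>i<k. n - s - i)" for k
    by (induction k) (simp_all add: mult.assoc)
  from this[of "b - s"] assms show ?thesis by simp
qed

lemma half_power_le_falling_factorial:
  assumes "2 * s \<le> n"
  shows "(real n / 2) ^ s \<le> real (\<Prod>i<s. n - i)"
proof -
  have "(\<Prod>i<s. real n / 2) \<le> (\<Prod>i<s. real (n - i))"
    using assms by (intro prod_mono) auto
  then show ?thesis by simp
qed

text \<open>Build \<open>f\<close> in stages. Its restriction \<open>t\<close> to \<open>S\<close>
  has at most \<open>card W ^ card S\<close> values. Given \<open>t\<close>, the vertex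
  \<open>u\<close> is one of the at most \<open>k\<close> vertices whose set \<open>N u\<close>
  contains the image of \<open>t\<close>. The rest of \<open>f\<close> then injects
  \<open>B - S\<close> into the \<open>D - card S\<close> remaining elements of
  \<open>N u\<close>.\<close>

lemma card_sparse_injections_le:
  fixes N :: "'u \<Rightarrow> 'w set" and S B :: "'b set"
  assumes "finite U" "finite W" "finite B" "S \<subseteq> B"
    and N: "\<And>u. u \<in> U \<Longrightarrow> N u \<subseteq> W" "\<And>u. u \<in> U \<Longrightarrow> card (N u) = D"
  shows "card {(u, f). u \<in> U \<and> f \<in> B \<rightarrow>\<^sub>E N u \<and> inj_on f B \<and> card {v \<in> U. f ` S \<subseteq> N v} \<le> k}
    \<le> card W ^ card S * (k * (\<Prod>i<card B - card S. D - card S - i))"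
    (is "card ?bad \<le> _ * (k * ?P)")
proof -
  have finS: "finite S" using assms finite_subset by blast
  have finN: "finite (N u)" if "u \<in> U" for u using N(1)[OF that] assms(2) finite_subset by blast
  define T where "T = {t \<in> S \<rightarrow>\<^sub>E W. inj_on t S \<and> card {v \<in> U. t ` S \<subseteq> N v} \<le> k}"
  define E where "E t u = {g \<in> (B - S) \<rightarrow>\<^sub>E (N u - t ` S). inj_on g (B - S)}" for t u
  define R where "R = (SIGMA t:T. SIGMA u:{v \<in> U. t ` S \<subseteq> N v}. E t u)"
  \<comment> \<open>This map is injective on the bad pairs because members of
    \<open>B \<rightarrow>\<^sub>E N u\<close> are \<open>undefined\<close> outside
    \<open>B\<close>, so the two restrictions determine \<open>f\<close>.\<close>
  define \<Phi> where "\<Phi> = (\<lambda>(u::'u, f::'b \<Rightarrow> 'w). (restrict f S, u, restrict f (B - S)))"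
  have finT: "finite T" unfolding T_def
    by (rule finite_subset[OF _ finite_PiE[of S "\<lambda>_. W"]]) (use finS assms in auto)
  have finE: "finite (E t u)" if "u \<in> U" for t u unfolding E_def
    by (rule finite_subset[OF _ finite_PiE[of "B - S" "\<lambda>_. N u - t ` S"]])
      (use finN that assms in auto)
  have cardE: "card (E t u) = ?P" if "t \<in> T" "u \<in> U" "t ` S \<subseteq> N u" for t u
  proof -
    have "card (N u - t ` S) = D - card S"
      using that finS N(2) by (simp add: T_def card_Diff_subset card_image)
    then show ?thesis
      using that finN assms finS unfolding E_def
      by (subst card_injections) (auto simp: card_Diff_subset)
  qed
  have finR: "finite R" unfolding R_def
    using finT finE assms(1) by (intro finite_SigmaI) auto
  have "inj_on \<Phi> ?bad"
  proof (rule inj_onI, clarify)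
    fix u f u' f'
    assume f: "f \<in> B \<rightarrow>\<^sub>E N u" "f' \<in> B \<rightarrow>\<^sub>E N u'" and eq: "\<Phi> (u, f) = \<Phi> (u', f')"
    have "f x = f' x" for x
    proof (cases "x \<in> B")
      case True
      have "restrict f S x = restrict f' S x" "restrict f (B - S) x = restrict f' (B - S) x"
        using eq by (simp_all add: \<Phi>_def)
      then show ?thesis using True by (cases "x \<in> S") auto
    next
      case False
      then show ?thesis using PiE_arb[OF f(1)] PiE_arb[OF f(2)] by simp
    qed
    then show "u = u' \<and> f = f'" using eq by (auto simp: \<Phi>_def)
  qed
  moreover have "\<Phi> ` ?bad \<subseteq> R"
  proof (rule image_subsetI, clarify)
    fix u f
    assume u: "u \<in> U" and f: "f \<in> B \<rightarrow>\<^sub>E N u" "inj_on f B"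
      and k: "card {v \<in> U. f ` S \<subseteq> N v} \<le> k"
    have fS: "f ` S \<subseteq> N u" using f assms(4) by auto
    have im: "restrict f S ` S = f ` S" by auto
    have "restrict f S \<in> T"
      using fS N(1)[OF u] inj_on_subset[OF f(2) assms(4)] k
      unfolding T_def by (auto simp: inj_on_restrict_eq)
    moreover have "restrict f (B - S) \<in> E (restrict f S) u"
    proof -
      have "f x \<notin> f ` S" if "x \<in> B - S" for x
        using f(2) that assms(4) by (auto dest: inj_onD)
      then show ?thesis
        using f inj_on_subset[OF f(2), of "B - S"] unfolding E_def im
        by (auto simp: inj_on_restrict_eq)
    qed
    ultimately show "\<Phi> (u, f) \<in> R" using u fS by (simp add: \<Phi>_def R_def)
  qed
  ultimately have "card ?bad \<le> card R" using card_inj_on_le finR by blast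
  also have "\<dots> = (\<Sum>t\<in>T. \<Sum>u\<in>{v \<in> U. t ` S \<subseteq> N v}. card (E t u))"
    unfolding R_def using finT finE assms(1)
    by (subst card_SigmaI) (auto intro!: sum.cong card_SigmaI)
  also have "\<dots> \<le> (\<Sum>t\<in>T. k * ?P)"
  proof (rule sum_mono)
    fix t assume t: "t \<in> T"
    have "(\<Sum>u\<in>{v \<in> U. t ` S \<subseteq> N v}. card (E t u)) = card {v \<in> U. t ` S \<subseteq> N v} * ?P"
      using cardE[OF t] by simp
    then show "(\<Sum>u\<in>{v \<in> U. t ` S \<subseteq> N v}. card (E t u)) \<le> k * ?P"
      using t by (simp add: T_def)
  qed
  also have "\<dots> = card T * (k * ?P)" by simp
  also have "card T \<le> card W ^ card S"
  proof -
    have "card T \<le> card (S \<rightarrow>\<^sub>E W)"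
      by (rule card_mono) (use finS assms in \<open>auto simp: T_def intro: finite_PiE\<close>)
    then show ?thesis using finS by (simp add: card_funcsetE)
  qed
  finally show ?thesis by simp
qed

text \<open>A union bound in natural numbers: multiplying \<open>few\<close> by the number of
  extensions shows that each \<open>a\<close> spoils fewer than a fraction \<open>1 / card A\<close>
  of all pairs, so some pair is spoiled by no \<open>a\<close>.\<close>

lemma exists_rich_injection:
  fixes N :: "'u \<Rightarrow> 'w set" and S :: "'a \<Rightarrow> 'b set"
  assumes "finite U" "U \<noteq> {}" "finite W" "finite A" "finite B" "card B \<le> D"
    and N: "\<And>u. u \<in> U \<Longrightarrow> N u \<subseteq> W" "\<And>u. u \<in> U \<Longrightarrow> card (N u) = D"
    and S: "\<And>a. a \<in> A \<Longrightarrow> S a \<subseteq> B"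
    and few: "\<And>a. a \<in> A \<Longrightarrow>
      card A * (card W ^ card (S a) * k) < card U * (\<Prod>i<card (S a). D - i)"
  obtains u f where "u \<in> U" "f \<in> B \<rightarrow>\<^sub>E N u" "inj_on f B"
    "\<And>a. a \<in> A \<Longrightarrow> k < card {v \<in> U. f ` S a \<subseteq> N v}"
proof -
  define X where "X = (SIGMA u:U. {f \<in> B \<rightarrow>\<^sub>E N u. inj_on f B})"
  define bad where "bad a =
    {(u, f). u \<in> U \<and> f \<in> B \<rightarrow>\<^sub>E N u \<and> inj_on f B \<and> card {v \<in> U. f ` S a \<subseteq> N v} \<le> k}" for a
  define P where "P = (\<Prod>i<card B. D - i)"
  have finN: "finite (N u)" if "u \<in> U" for u using N(1)[OF that] assms(3) finite_subset by blast
  have fin: "finite {f \<in> B \<rightarrow>\<^sub>E N u. inj_on f B}" if "u \<in> U" for u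
    by (rule finite_subset[OF _ finite_PiE[of B "\<lambda>_. N u"]]) (use finN that assms in auto)
  have finX: "finite X" unfolding X_def using fin assms(1) by (intro finite_SigmaI) auto
  have badX: "bad a \<subseteq> X" for a by (auto simp: bad_def X_def)
  have cardX: "card X = card U * P"
    unfolding X_def P_def using fin assms(1) finN N(2) assms(5)
    by (subst card_SigmaI) (auto simp: card_injections)
  have P0: "P > 0" unfolding P_def using assms(6) by (intro prod_pos) auto
  have U0: "card U > 0" using assms(1,2) by (simp add: card_gt_0_iff)
  have small: "card A * card (bad a) < card X" if a: "a \<in> A" for a
  proof -
    let ?s = "card (S a)"
    let ?Q = "\<Prod>i<card B - ?s. D - ?s - i"
    have s: "?s \<le> card B" using S[OF a] assms(5) by (rule card_mono[rotated])
    have split: "P = (\<Prod>i<?s. D - i) * ?Q"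
      unfolding P_def by (rule falling_factorial_split[OF s])
    \<comment> \<open>Positivity keeps \<open>few\<close> strict after multiplication by
      \<open>?Q\<close>; it comes from \<open>card B \<le> D\<close> through
      \<open>P > 0\<close>.\<close>
    then have Q0: "?Q > 0" using P0 by (metis gr0I mult_is_0)
    have "card (bad a) \<le> card W ^ ?s * (k * ?Q)"
      unfolding bad_def using assms N S[OF a] by (intro card_sparse_injections_le) auto
    then have "card A * card (bad a) \<le> card A * (card W ^ ?s * (k * ?Q))" by simp
    also have "\<dots> = card A * (card W ^ ?s * k) * ?Q" by simp
    also have "\<dots> < card U * (\<Prod>i<?s. D - i) * ?Q"
      using few[OF a] Q0 by (rule mult_strict_right_mono)
    finally show ?thesis by (simp only: cardX split mult.assoc)
  qed
  have "card (\<Union>a\<in>A. bad a) < card X"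
  \<comment> \<open>Strict monotonicity of the sum requires a nonempty index set; for empty
    \<open>A\<close> it suffices that \<open>X\<close> is nonempty.\<close>
  proof (cases "A = {}")
    case True
    then show ?thesis using P0 U0 cardX by simp
  next
    case False
    have "card A * card (\<Union>a\<in>A. bad a) \<le> card A * (\<Sum>a\<in>A. card (bad a))"
      by (intro mult_le_mono2 card_UN_le assms(4))
    also have "\<dots> = (\<Sum>a\<in>A. card A * card (bad a))" by (simp add: sum_distrib_left)
    also have "\<dots> < (\<Sum>a\<in>A. card X)" using False assms(4) small by (intro sum_strict_mono) auto
    also have "\<dots> = card A * card X" by simp
    finally show ?thesis by simp
  qed
  then have "\<not> X \<subseteq> (\<Union>a\<in>A. bad a)"
    using card_mono[of "\<Union>a\<in>A. bad a" X] finX badX assms(4)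
    by (metis UN_least finite_subset not_le)
  then obtain u f where uf: "(u, f) \<in> X" "\<And>a. a \<in> A \<Longrightarrow> (u, f) \<notin> bad a" by auto
  have "k < card {v \<in> U. f ` S a \<subseteq> N v}" if "a \<in> A" for a
    using uf(1) uf(2)[OF that] by (auto simp: X_def bad_def)
  then show thesis using that uf(1) by (auto simp: X_def)
qed

section \<open>From a good injection to a copy of \<open>H\<close>\<close>

text \<open>Greedy choice: fewer than \<open>card A\<close> values are taken at each stage, so the
  next \<open>C a\<close> still has a free element.\<close>

lemma exists_injective_choice:
  assumes "finite A" "\<And>a. a \<in> A \<Longrightarrow> card A \<le> card (C a)"
  obtains g where "inj_on g A" "\<And>a. a \<in> A \<Longrightarrow> g a \<in> C a"
proof -
  from assms have "\<exists>g. inj_on g A \<and> (\<forall>a\<in>A. g a \<in> C a)"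
  proof (induction A rule: finite_induct)
    case empty
    then show ?case by simp
  next
    case (insert x F)
    have "card F \<le> card (C a)" if "a \<in> F" for a
      using insert.prems[of a] insert.hyps that by simp
    with insert.IH obtain g where g: "inj_on g F" "\<forall>a\<in>F. g a \<in> C a" by blast
    have "card (g ` F) < card (C x)"
      using insert.prems[of x] insert.hyps card_image_le[OF insert.hyps(1), of g] by simp
    then obtain y where y: "y \<in> C x" "y \<notin> g ` F"
      using insert.hyps(1) by (metis card_mono finite_imageI not_le subsetI)
    have "inj_on (g(x := y)) (insert x F)"
      using g(1) y(2) insert.hyps(2) by (auto simp: inj_on_def)
    moreover have "\<forall>a\<in>insert x F. (g(x := y)) a \<in> C a" using g(2) y(1) by auto
    ultimately show ?case by blast
  qed
  then show thesis using that by blast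
qed

text \<open>An arc of \<open>H\<close> is determined by its ends, as \<open>H\<close> has no
  parallel arcs. Hence arcs of \<open>G\<close> chosen over the images of these ends are distinct,
  and \<open>\<phi>\<close> extends to an isomorphism onto a subgraph.\<close>

lemma contains_copyI:
  assumes "wf_digraph G" "nomulti_digraph H"
    and inj: "inj_on \<phi> (verts H)" and "\<phi> ` verts H \<subseteq> verts G"
    and arc: "\<And>e. e \<in> arcs H \<Longrightarrow> \<phi> (tail H e) \<rightarrow>\<^bsub>G\<^esub> \<phi> (head H e)"
  shows "contains_copy G H"
proof -
  interpret G: wf_digraph G by fact
  interpret H: nomulti_digraph H by fact
  have "\<forall>e\<in>arcs H. \<exists>e'\<in>arcs G. tail G e' = \<phi> (tail H e) \<and> head G e' = \<phi> (head H e)"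
    using arc by (force simp: arcs_ends_conv)
  then obtain \<psi> where \<psi>: "\<And>e. e \<in> arcs H \<Longrightarrow> \<psi> e \<in> arcs G"
    "\<And>e. e \<in> arcs H \<Longrightarrow> tail G (\<psi> e) = \<phi> (tail H e)"
    "\<And>e. e \<in> arcs H \<Longrightarrow> head G (\<psi> e) = \<phi> (head H e)"
    by metis
  \<comment> \<open>Reusing \<open>head G\<close> and \<open>tail G\<close> makes the image
    compatible with \<open>G\<close>, as \<open>subgraph\<close> demands.\<close>
  define m where "m = \<lparr>iso_verts = \<phi>, iso_arcs = \<psi>, iso_head = head G, iso_tail = tail G\<rparr>"
  have "inj_on \<psi> (arcs H)"
  proof (rule inj_onI)
    fix e1 e2 assume e: "e1 \<in> arcs H" "e2 \<in> arcs H" "\<psi> e1 = \<psi> e2"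
    then have "\<phi> (tail H e1) = \<phi> (tail H e2)" "\<phi> (head H e1) = \<phi> (head H e2)"
      using \<psi>(2,3) by metis+
    then have "arc_to_ends H e1 = arc_to_ends H e2"
      using inj e by (auto simp: arc_to_ends_def dest: inj_onD)
    then show "e1 = e2" using e H.no_multi_arcs by blast
  qed
  then have "pre_digraph.digraph_isomorphism H m"
    using inj \<psi> H.wf_digraph by (simp add: pre_digraph.digraph_isomorphism_def m_def)
  then have "digraph_iso H (app_iso m H)" by (auto simp: digraph_iso_def)
  moreover have "wf_digraph (app_iso m H)"
    by unfold_locales (auto simp: m_def \<psi>)
  then have "subgraph (app_iso m H) G"
    using assms(4) \<psi>(1) G.wf_digraph by (auto simp: subgraph_def compatible_def m_def)
  ultimately show ?thesis by (auto simp: contains_copy_def)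
qed

theorem theorem4p4:
  fixes r h :: nat and d :: real
    and G :: "('a, 'b) pre_digraph" and U W :: "'a set"
    and H :: "('c, 'd) pre_digraph" and A B :: "'c set"
  assumes "r \<ge> 1" and "h \<ge> 1"
    and "d \<ge> max 40 (2 * real h)"
    and "bipartite_digraph G U W"
    and "\<And>u. u \<in> U \<Longrightarrow> real (card (out_nbrs G W u)) \<ge> d"
    and "bipartite_digraph H A B"
    and "card (verts H) = h"
    and "\<And>a. a \<in> A \<Longrightarrow> card (out_nbrs H B a) \<le> r"
    and "1 / (2 * real (card W)) * (real (card U) / (4 * real h)) powr (1 / real r) * (d / 2)
           \<ge> max 20 (real h)"
  shows "contains_copy G H"
proof -
  interpret G: digraph G using assms(4) by (simp add: bipartite_digraph_def)
  interpret H: digraph H using assms(6) by (simp add: bipartite_digraph_def)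
  have G: "verts G = U \<union> W" "U \<inter> W = {}"
    using assms(4) by (auto simp: bipartite_digraph_def)
  have H: "verts H = A \<union> B" "A \<inter> B = {}"
    and H_arc: "\<And>e. e \<in> arcs H \<Longrightarrow> tail H e \<in> A \<and> head H e \<in> B"
    using assms(6) by (auto simp: bipartite_digraph_def)
  have fin: "finite U" "finite W" "finite A" "finite B"
    using G.finite_verts H.finite_verts G H by auto
  have cardAB: "card A \<le> h" "card B \<le> h"
    using assms(7) H fin by (auto simp: card_Un_disjoint)
  have d: "d \<ge> 40" "d \<ge> 2 * real h" using assms(3) by auto
  define m where "m = max 20 (real h)"
  have m: "m \<ge> 20" "m \<ge> real h" by (auto simp: m_def)
  have cond: "1 / (2 * real (card W)) * (real (card U) / (4 * real h)) powr (1 / real r) * (d / 2) \<ge> m"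
    using assms(9) by (simp add: m_def)
  \<comment> \<open>Division by zero yields 0 and \<open>0 powr y\<close> is 0, so an empty
    \<open>W\<close> or \<open>U\<close> would make the left side of \<open>cond\<close> vanish,
    against \<open>m \<ge> 20\<close>.\<close>
  have W0: "card W > 0" using cond m by (cases "card W = 0") auto
  have U0: "card U > 0" using cond m by (cases "card U = 0") auto
  then have Une: "U \<noteq> {}" by auto
  then obtain u0 where "u0 \<in> U" by blast
  then have dW: "d \<le> real (card W)"
    using assms(5)[of u0] card_mono[OF fin(2), of "out_nbrs G W u0"]
    by (fastforce simp: out_nbrs_def)
  \<comment> \<open>Since \<open>d\<close> is real, it is rounded up; out-degrees are integers, so
    they are still at least \<open>D\<close>.\<close>
  define D where "D = nat \<lceil>d\<rceil>"
  have dD: "d \<le> real D" unfolding D_def by linarith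
  have D2h: "2 * h \<le> D" using d(2) dD by linarith
  have "\<exists>M \<subseteq> out_nbrs G W u. card M = D" if "u \<in> U" for u
  proof -
    have "D \<le> card (out_nbrs G W u)"
      using assms(5)[OF that] unfolding D_def by linarith
    then show ?thesis by (meson obtain_subset_with_card_n)
  qed
  then obtain N where N: "\<And>u. u \<in> U \<Longrightarrow> N u \<subseteq> out_nbrs G W u" "\<And>u. u \<in> U \<Longrightarrow> card (N u) = D"
    by metis
  have NW: "N u \<subseteq> W" if "u \<in> U" for u using N(1)[OF that] by (auto simp: out_nbrs_def)

  \<comment> \<open>This is \<open>cond\<close> solved for the \<open>powr\<close> term, giving
    \<open>x ^ r \<le> card U / (4 * h)\<close>. The bound \<open>x \<ge> 1\<close> later allows
    passing from exponent \<open>s\<close> to \<open>r\<close>.\<close>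
  define x where "x = 4 * m * real (card W) / d"
  have x4: "x \<ge> 4 * m"
    unfolding x_def using dW d m by (simp add: field_simps mult_left_mono)
  have x1: "x \<ge> 1" using x4 m by linarith
  have "x \<le> (real (card U) / (4 * real h)) powr (1 / real r)"
    using cond W0 d unfolding x_def by (simp add: field_simps)
  then have "x powr real r \<le> ((real (card U) / (4 * real h)) powr (1 / real r)) powr real r"
    using x1 by (intro powr_mono2) auto
  then have "x ^ r \<le> real (card U) / (4 * real h)"
    using x1 assms(1,2) U0 by (simp add: powr_powr powr_realpow)
  then have Ux: "4 * real h * x ^ r \<le> real (card U)"
    using assms(2) by (simp add: field_simps)

  have few: "card A * (card W ^ card (out_nbrs H B a) * h)
      < card U * (\<Prod>i<card (out_nbrs H B a). D - i)" if a: "a \<in> A" for a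
  proof -
    define s where "s = card (out_nbrs H B a)"
    have sr: "s \<le> r" using assms(8)[OF a] by (simp add: s_def)
    have "s \<le> card B" unfolding s_def using fin by (intro card_mono) (auto simp: out_nbrs_def)
    then have sh: "2 * s \<le> D" using cardAB D2h by linarith
    have hm: "real h * real h < 4 * real h * (2 * m)"
      using m assms(2) by (simp add: mult.commute[of _ m])
    have "real (card A * (card W ^ s * h)) \<le> real h * (real (card W) ^ s * real h)"
      using cardAB by (simp add: mult_right_mono)
    also have "\<dots> = (real h * real h) * real (card W) ^ s" by simp
    also have "\<dots> < 4 * real h * (2 * m) * real (card W) ^ s"
      using hm W0 by (intro mult_strict_right_mono) auto
    also have "\<dots> \<le> real (card U) * (d / 2) ^ s"
    \<comment> \<open>The bound \<open>2 * m \<le> (2 * m) ^ s\<close> fails for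
      \<open>s = 0\<close>; there \<open>2 * m \<le> x \<le> x ^ r\<close> replaces it.\<close>
    proof (cases "s = 0")
      case True
      have "x ^ 1 \<le> x ^ r" using x1 assms(1) by (intro power_increasing) auto
      then have "2 * m \<le> x ^ r" using x4 m by simp
      then have "4 * real h * (2 * m) \<le> 4 * real h * x ^ r" by (intro mult_left_mono) auto
      then have "4 * real h * (2 * m) \<le> real (card U)" using Ux by (rule order_trans)
      then show ?thesis using True by simp
    next
      case False
      have "2 * m \<le> (2 * m) ^ s" using False m by (intro self_le_power) auto
      then have "4 * real h * (2 * m) * real (card W) ^ s
          \<le> 4 * real h * (2 * m) ^ s * real (card W) ^ s"
        by (intro mult_right_mono mult_left_mono) auto
      also have "\<dots> = 4 * real h * x ^ s * (d / 2) ^ s"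
      proof -
        \<comment> \<open>The factor \<open>2 * m\<close> was absorbed into the power precisely so
          that this identity trades \<open>card W\<close> for \<open>d / 2\<close>.\<close>
        have "2 * m * real (card W) = x * (d / 2)" using d by (simp add: x_def)
        then show ?thesis by (metis mult.assoc power_mult_distrib)
      qed
      also have "\<dots> \<le> 4 * real h * x ^ r * (d / 2) ^ s"
        using x1 sr d by (intro mult_right_mono mult_left_mono power_increasing) auto
      also have "\<dots> \<le> real (card U) * (d / 2) ^ s"
        using Ux d by (intro mult_right_mono) auto
      finally show ?thesis .
    qed
    also have "\<dots> \<le> real (card U) * (real D / 2) ^ s"
      using dD d by (intro mult_left_mono power_mono) auto
    also have "\<dots> \<le> real (card U) * real (\<Prod>i<s. D - i)"
      using half_power_le_falling_factorial[OF sh] by (intro mult_left_mono) auto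
    finally have "real (card A * (card W ^ s * h)) < real (card U * (\<Prod>i<s. D - i))"
      by simp
    then show ?thesis unfolding s_def of_nat_less_iff .
  qed

  have nbrs_sub: "out_nbrs H B a \<subseteq> B" for a by (auto simp: out_nbrs_def)
  have "card B \<le> D" using cardAB D2h by linarith
  then obtain u f where f: "u \<in> U" "f \<in> B \<rightarrow>\<^sub>E N u" "inj_on f B"
    "\<And>a. a \<in> A \<Longrightarrow> h < card {v \<in> U. f ` out_nbrs H B a \<subseteq> N v}"
    by (rule exists_rich_injection[where N = N and S = "out_nbrs H B" and k = h,
          OF fin(1) Une fin(2,3,4)]) (erule NW N(2) few | rule nbrs_sub | blast)+
  \<comment> \<open>The choice \<open>k = h\<close> leaves enough candidates for every vertex of
    \<open>A\<close>, because \<open>card A \<le> h\<close>.\<close>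
  have "card A \<le> card {v \<in> U. f ` out_nbrs H B a \<subseteq> N v}" if "a \<in> A" for a
    using f(4)[OF that] cardAB(1) by linarith
  with fin(3) obtain g where g: "inj_on g A"
    "\<And>a. a \<in> A \<Longrightarrow> g a \<in> {v \<in> U. f ` out_nbrs H B a \<subseteq> N v}"
    by (rule exists_injective_choice) blast+
  \<comment> \<open>\<open>A\<close> goes into \<open>U\<close> and \<open>B\<close> into
    \<open>W\<close>, so disjointness of \<open>U\<close> and \<open>W\<close> prevents collisions
    between the two sides.\<close>
  define \<phi> where "\<phi> v = (if v \<in> A then g v else f v)" for v
  have \<phi>A: "\<phi> a = g a" "g a \<in> U" if "a \<in> A" for a
    using that g(2)[OF that] by (auto simp: \<phi>_def)
  have \<phi>B: "\<phi> b = f b" "f b \<in> W" if "b \<in> B" for b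
    using that f(1,2) NW H(2) by (auto simp: \<phi>_def)
  show ?thesis
  proof (rule contains_copyI)
    show "wf_digraph G" "nomulti_digraph H" by unfold_locales
    show "inj_on \<phi> (verts H)" unfolding H(1)
    proof (rule inj_onI)
      fix v w assume "v \<in> A \<union> B" "w \<in> A \<union> B" "\<phi> v = \<phi> w"
      then show "v = w"
        using \<phi>A \<phi>B G(2) inj_onD[OF g(1), of v w] inj_onD[OF f(3), of v w]
        by (metis Un_iff disjoint_iff)
    qed
    show "\<phi> ` verts H \<subseteq> verts G" using \<phi>A \<phi>B G(1) H(1) by auto
    fix e assume e: "e \<in> arcs H"
    have t: "tail H e \<in> A" and b: "head H e \<in> B" using H_arc[OF e] by auto
    have "head H e \<in> out_nbrs H B (tail H e)"
      using e b by (auto simp: out_nbrs_def arcs_ends_conv)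
    then have "f (head H e) \<in> N (g (tail H e))" using g(2)[OF t] by auto
    then show "\<phi> (tail H e) \<rightarrow>\<^bsub>G\<^esub> \<phi> (head H e)"
      using N(1)[OF \<phi>A(2)[OF t]] \<phi>A(1)[OF t] \<phi>B(1)[OF b] by (auto simp: out_nbrs_def)
  qed
qed

end
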